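(* Let $n,m,p\in\mathbb{Z}_{>0}$, $A\in\mathbb{R}^{n\times n}$, $B\in\mathbb{R}^{n\times m}$ with $(A,B)$ stabilizable, and let $C\in\mathbb{R}^{p\times n}$, $D\in\mathbb{R}^{p\times m}$ be such that $Q:=C^\top C\succ0$, $R:=D^\top D\succ 0$ and $C^\top D=\mathbf{0}$. Fix any $\gamma\in[0,1]$, $\mu\in\mathbb{R}_{>0}$ and $x_0\in\mathbb{R}^n$. Suppose there exist symmetric matrices $X_\gamma,Z_\gamma\in\mathbb{R}^{n\times n}$ and matrices $G_\gamma\in\mathbb{R}^{n\times n}$, $Y_\gamma\in\mathbb{R}^{m\times n}$ such that the following system of matrix inequalities holds: $$\begin{bmatrix}\mu & (\bullet)^\top\\ x_0 & X_\gamma\end{bmatrix}\succeq 0,$$ $$\begin{bmatrix}G_\gamma+G_\gamma^\top-X_\gamma & (\bullet)^\top & (\bullet)^\top\\ \sqrt{\gamma}AG_\gamma+\sqrt{\gamma}BY_\gamma & X_\gamma & (\bullet)^\top\\ CG_\gamma+DY_\gamma & \mathbf{0} & \mathbf{1}\end{bmatrix}\succeq 0,$$ $$\begin{bmatrix}G_\gamma+G_\gamma^\top-Z_\gamma & (\bullet)^\top\\ AG_\gamma+BY_\gamma & Z_\gamma\end{bmatrix}\succ 0.$$ Then $\widehat K_\gamma=Y_\gamma G_\gamma^{-1}$ satisfies $\widehat K_\gamma\in\mathcal{K}_1$, i.e., $\rho(A+B\widehat K_\gamma)<1$, and $$J_\gamma(x_0,\widehat K_\gamma)\le x_0^\top X_\gamma^{-1}x_0\le\mu.$$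 Moreover, if this system of inequalities is feasible for some $\gamma$, then it is feasible for all $\gamma'\in[0,\gamma]$ (i.e., with $\gamma$ replaced by $\gamma'$).
   Context: $\rho(M)$ denotes the spectral radius of a square matrix $M$; $\succ0$ (resp. $\succeq 0$) means symmetric positive definite (resp. semidefinite); $\mathbf{1}$ and $\mathbf{0}$ are identity and zero matrices of appropriate dimensions; $(\bullet)^\top$ in a block matrix denotes the block making the matrix symmetric. $(A,B)$ stabilizable means there is $K\in\mathbb{R}^{m\times n}$ with $\rho(A+BK)<1$. $\mathcal{K}_1:=\{K\in\mathbb{R}^{m\times n}:\rho(A+BK)<1\}$. For $K\in\mathbb{R}^{m\times n}$, $J_\gamma(x_0,K):=\sum_{k=0}^\infty\gamma^k\,(x_k^\top Qx_k+u_k^\top Ru_k)$, where $x_{k+1}=Ax_k+Bu_k$, $u_k=Kx_k$ for all $k\ge0$, with initial state $x_0$.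
   Formalization: The inequalities do not force X_γ to be invertible (e.g. A=0, B=0, x_0=0, X_γ=0 is feasible), so the chain J_γ ≤ x_0^T X_γ^{-1} x_0 ≤ μ is stated only for invertible X_γ; the bound J_γ ≤ μ, stability and the feasibility claim are stated for every feasible X_γ. *)

theory Defs
  imports "HOL-Analysis.Analysis"
begin

definition spectral_radius :: "real^'n^'n \<Rightarrow> real" where
  "spectral_radius M =
     Max {cmod l |l. \<exists>v. v \<noteq> 0 \<and> map_matrix complex_of_real M *v v = l *s v}"

definition symmetric_matrix :: "real^'n^'n \<Rightarrow> bool" where
  "symmetric_matrix M \<longleftrightarrow> transpose M = M"

definition pos_def :: "real^'n^'n \<Rightarrow> bool" where
  "pos_def M \<longleftrightarrow> symmetric_matrix M \<and> (\<forall>x. x \<noteq> 0 \<longrightarrow> 0 < x \<bullet> (M *v x))"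

definition pos_semidef :: "real^'n^'n \<Rightarrow> bool" where
  "pos_semidef M \<longleftrightarrow> symmetric_matrix M \<and> (\<forall>x. 0 \<le> x \<bullet> (M *v x))"

text \<open>
  Block matrices are indexed by sum types. The symmetric ones are given by their lower
  triangular blocks, row by row; each block above the diagonal is the transpose of its
  mirror image. For instance \<open>sym_block3 P S W T U V\<close> has the rows
  \<open>[P, S\<^sup>T, T\<^sup>T]\<close>, \<open>[S, W, U\<^sup>T]\<close>, \<open>[T, U, V]\<close>.
\<close>

definition stack :: "real^'k^'a \<Rightarrow> real^'k^'b \<Rightarrow> real^'k^('a + 'b)" where
  "stack S T = (\<chi> i. case i of Inl a \<Rightarrow> S $ a | Inr b \<Rightarrow> T $ b)"

definition sym_block2 ::
    "real^'a^'a \<Rightarrow> real^'a^'b \<Rightarrow> real^'b^'b \<Rightarrow> real^('a + 'b)^('a + 'b)" where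
  "sym_block2 P S W = (\<chi> i j. case i of
       Inl a \<Rightarrow> (case j of Inl a' \<Rightarrow> P $ a $ a' | Inr b' \<Rightarrow> transpose S $ a $ b')
     | Inr b \<Rightarrow> (case j of Inl a' \<Rightarrow> S $ b $ a' | Inr b' \<Rightarrow> W $ b $ b'))"

definition sym_block3 ::
    "real^'a^'a \<Rightarrow> real^'a^'b \<Rightarrow> real^'b^'b \<Rightarrow> real^'a^'c \<Rightarrow> real^'b^'c \<Rightarrow> real^'c^'c
      \<Rightarrow> real^('a + ('b + 'c))^('a + ('b + 'c))" where
  "sym_block3 P S W T U V = sym_block2 P (stack S T) (sym_block2 W U V)"

definition stabilizing_gains :: "real^'n^'n \<Rightarrow> real^'m^'n \<Rightarrow> (real^'n^'m) set" where
  "stabilizing_gains A B = {K. spectral_radius (A + B ** K) < 1}"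

definition stabilizable :: "real^'n^'n \<Rightarrow> real^'m^'n \<Rightarrow> bool" where
  "stabilizable A B \<longleftrightarrow> (\<exists>K. spectral_radius (A + B ** K) < 1)"

primrec state :: "real^'n^'n \<Rightarrow> real^'m^'n \<Rightarrow> real^'n^'m \<Rightarrow> real^'n \<Rightarrow> nat \<Rightarrow> real^'n" where
  "state A B K x0 0 = x0"
| "state A B K x0 (Suc k) = A *v state A B K x0 k + B *v (K *v state A B K x0 k)"

text \<open>
  The cost is a series of nonnegative terms, possibly divergent, so its value is an extended
  real: a finite upper bound on it includes convergence.
\<close>

definition discounted_cost ::
    "real^'n^'n \<Rightarrow> real^'m^'n \<Rightarrow> real^'n^'n \<Rightarrow> real^'m^'m \<Rightarrow> real \<Rightarrow> real^'n \<Rightarrow> real^'n^'m \<Rightarrow> ereal"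
  where
  "discounted_cost A B Q R \<gamma> x0 K =
     (\<Sum>k. ereal (\<gamma> ^ k *
        (let x = state A B K x0 k; u = K *v x in x \<bullet> (Q *v x) + u \<bullet> (R *v u))))"

definition lmi_system ::
    "real^'n^'n \<Rightarrow> real^'m^'n \<Rightarrow> real^'n^'p \<Rightarrow> real^'m^'p \<Rightarrow> real \<Rightarrow> real^'n \<Rightarrow> real
      \<Rightarrow> real^'n^'n \<Rightarrow> real^'n^'n \<Rightarrow> real^'n^'n \<Rightarrow> real^'n^'m \<Rightarrow> bool" where
  "lmi_system A B C D \<mu> x0 \<gamma> X Z G Y \<longleftrightarrow>
     symmetric_matrix X \<and> symmetric_matrix Z \<and>
     pos_semidef (sym_block2 (mat \<mu> :: real^1^1) (columnvector x0) X) \<and>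
     pos_semidef (sym_block3
       (G + transpose G - X)
       (sqrt \<gamma> *\<^sub>R (A ** G) + sqrt \<gamma> *\<^sub>R (B ** Y)) X
       (C ** G + D ** Y) 0 (mat 1)) \<and>
     pos_def (sym_block2
       (G + transpose G - Z)
       (A ** G + B ** Y) Z)"

end

theory Submission
  imports Defs "HOL-Computational_Algebra.Fundamental_Theorem_Algebra"
begin

text \<open>
  Write \<open>K = Y G\<^sup>-\<^sup>1\<close> and \<open>M = A + B K\<close>, so that \<open>A G + B Y = M G\<close>. Testing the last block inequality
  on \<open>(-M\<^sup>T w, w)\<close> cancels \<open>G\<close> and leaves \<open>M Z M\<^sup>T \<prec> Z\<close>, a Lyapunov inequality for \<open>M\<^sup>T\<close>; hence the
  spectral radius of \<open>M\<close> is below 1. Similarly, with \<open>N = \<surd>\<gamma> M\<close> and \<open>E = C + D K\<close>, testing the second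
  inequality on \<open>(-s, w, z)\<close> with \<open>s = N\<^sup>T w + E\<^sup>T z\<close> gives \<open>s\<^sup>T X s \<le> w\<^sup>T X w + z\<^sup>T z\<close>. By Cauchy--Schwarz
  for the form \<open>X\<close> this dualises to the statement that \<open>x\<^sup>T X\<^sup>-\<^sup>1 x\<close> decreases along \<open>x \<mapsto> N x\<close> by at
  least \<open>|E x|\<^sup>2\<close>, the discounted stage cost, and summation bounds the total cost. The first inequality
  puts \<open>x\<^sub>0\<close> in the range of \<open>X\<close> and bounds \<open>x\<^sub>0\<^sup>T X\<^sup>-\<^sup>1 x\<^sub>0\<close> by \<open>\<mu>\<close>. Lowering \<open>\<gamma>\<close> amounts to scaling \<open>w\<close> by
  a factor in \<open>[0, 1]\<close>, so the same matrices remain feasible.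
\<close>

section \<open>Quadratic forms of block matrices\<close>

definition vec_append :: "'k^'a \<Rightarrow> 'k^'b \<Rightarrow> 'k^('a + 'b)" where
  "vec_append v w = (\<chi> i. case i of Inl a \<Rightarrow> v $ a | Inr b \<Rightarrow> w $ b)"

lemma vec_append_nth [simp]:
  "vec_append v w $ Inl a = v $ a" "vec_append v w $ Inr b = w $ b"
  by (simp_all add: vec_append_def)

lemma all_vec_append_iff:
  fixes P :: "'k^('a::finite + 'b::finite) \<Rightarrow> bool"
  shows "(\<forall>u. P u) \<longleftrightarrow> (\<forall>v w. P (vec_append v w))"
proof -
  have "u = vec_append (\<chi> a. u $ Inl a) (\<chi> b. u $ Inr b)" for u :: "'k^('a::finite + 'b::finite)"
    by (simp add: vec_eq_iff split_sum_all)
  then show ?thesis by metis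
qed

lemma vec_append_eq_0_iff: "vec_append v w = 0 \<longleftrightarrow> v = 0 \<and> w = (0 :: 'k::zero^'b)"
  by (simp add: vec_eq_iff split_sum_all)

lemma sum_UNIV_sum:
  fixes f :: "'a::finite + 'b::finite \<Rightarrow> 'c::comm_monoid_add"
  shows "sum f UNIV = (\<Sum>a\<in>UNIV. f (Inl a)) + (\<Sum>b\<in>UNIV. f (Inr b))"
  unfolding UNIV_Plus_UNIV[symmetric] by (subst sum.Plus) (simp_all add: comp_def)

lemma inner_vec_append:
  fixes v v' :: "real^'a" and w w' :: "real^'b"
  shows "vec_append v w \<bullet> vec_append v' w' = v \<bullet> v' + w \<bullet> w'"
  by (simp add: inner_vec_def sum_UNIV_sum)

lemma stack_mult_vec: "stack S T *v v = vec_append (S *v v) (T *v v)"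
  by (simp add: stack_def matrix_vector_mult_def vec_eq_iff split_sum_all)

lemma sym_block2_mult_vec:
  "sym_block2 P S W *v vec_append v w =
     vec_append (P *v v + transpose S *v w) (S *v v + W *v w)"
  by (simp add: sym_block2_def matrix_vector_mult_def vec_eq_iff sum_UNIV_sum split_sum_all)

lemma sym_block2_quadratic_form:
  "vec_append v w \<bullet> (sym_block2 P S W *v vec_append v w) =
     v \<bullet> (P *v v) + 2 * (w \<bullet> (S *v v)) + w \<bullet> (W *v w)"
proof -
  have "v \<bullet> (transpose S *v w) = w \<bullet> (S *v v)"
    by (metis dot_lmul_matrix inner_commute transpose_matrix_vector)
  then show ?thesis
    by (simp add: sym_block2_mult_vec inner_vec_append inner_add_right)
qed

lemma sym_block3_quadratic_form:
  "vec_append v (vec_append w z) \<bullet> (sym_block3 P S W T U V *v vec_append v (vec_append w z)) =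
     v \<bullet> (P *v v) + 2 * (w \<bullet> (S *v v)) + 2 * (z \<bullet> (T *v v))
     + w \<bullet> (W *v w) + 2 * (z \<bullet> (U *v w)) + z \<bullet> (V *v z)"
  by (simp add: sym_block3_def sym_block2_quadratic_form stack_mult_vec inner_vec_append)

text \<open>The off-diagonal blocks mirror each other by construction, so only the diagonal blocks
  can break symmetry.\<close>

lemma symmetric_matrix_sym_block2_iff:
  "symmetric_matrix (sym_block2 P S W) \<longleftrightarrow> symmetric_matrix P \<and> symmetric_matrix W"
proof -
  have "transpose (sym_block2 P S W) = sym_block2 (transpose P) S (transpose W)"
    by (simp add: sym_block2_def transpose_def vec_eq_iff split_sum_all)
  moreover have "sym_block2 P' S W' = sym_block2 P S W \<longleftrightarrow> P' = P \<and> W' = W" for P' W'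
  proof
    assume eq: "sym_block2 P' S W' = sym_block2 P S W"
    have "P' $ a $ a' = P $ a $ a'" for a a'
      using arg_cong[OF eq, of "\<lambda>M. M $ Inl a $ Inl a'"] by (simp add: sym_block2_def)
    moreover have "W' $ b $ b' = W $ b $ b'" for b b'
      using arg_cong[OF eq, of "\<lambda>M. M $ Inr b $ Inr b'"] by (simp add: sym_block2_def)
    ultimately show "P' = P \<and> W' = W"
      by (simp add: vec_eq_iff)
  qed simp
  ultimately show ?thesis
    by (simp add: symmetric_matrix_def)
qed

lemma pos_semidef_sym_block2_iff:
  "pos_semidef (sym_block2 P S W) \<longleftrightarrow>
     symmetric_matrix P \<and> symmetric_matrix W \<and>
     (\<forall>v w. 0 \<le> v \<bullet> (P *v v) + 2 * (w \<bullet> (S *v v)) + w \<bullet> (W *v w))"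
  unfolding pos_semidef_def symmetric_matrix_sym_block2_iff
  by (simp add: all_vec_append_iff sym_block2_quadratic_form)

lemma pos_def_sym_block2_iff:
  "pos_def (sym_block2 P S W) \<longleftrightarrow>
     symmetric_matrix P \<and> symmetric_matrix W \<and>
     (\<forall>v w. v \<noteq> 0 \<or> w \<noteq> 0 \<longrightarrow> 0 < v \<bullet> (P *v v) + 2 * (w \<bullet> (S *v v)) + w \<bullet> (W *v w))"
  unfolding pos_def_def symmetric_matrix_sym_block2_iff
  by (simp add: all_vec_append_iff sym_block2_quadratic_form vec_append_eq_0_iff)

lemma pos_semidef_sym_block3_iff:
  "pos_semidef (sym_block3 P S W T U V) \<longleftrightarrow>
     symmetric_matrix P \<and> symmetric_matrix W \<and> symmetric_matrix V \<and>
     (\<forall>v w z. 0 \<le> v \<bullet> (P *v v) + 2 * (w \<bullet> (S *v v)) + 2 * (z \<bullet> (T *v v))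
                  + w \<bullet> (W *v w) + 2 * (z \<bullet> (U *v w)) + z \<bullet> (V *v z))"
proof -
  have "symmetric_matrix (sym_block3 P S W T U V) \<longleftrightarrow>
      symmetric_matrix P \<and> symmetric_matrix W \<and> symmetric_matrix V"
    by (simp add: sym_block3_def symmetric_matrix_sym_block2_iff)
  then show ?thesis
    unfolding pos_semidef_def by (simp add: all_vec_append_iff sym_block3_quadratic_form)
qed

section \<open>Semidefinite matrices\<close>

lemma inner_transpose_mult_vec:
  fixes M :: "real^'n^'m"
  shows "v \<bullet> (transpose M *v w) = (M *v v) \<bullet> w"
  by (metis dot_lmul_matrix inner_commute transpose_matrix_vector)

lemma matrix_vector_mult_minus_right:
  fixes M :: "'a::ring_1^'n^'m"
  shows "M *v (- v) = - (M *v v)"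
  by (simp add: matrix_vector_mult_def vec_eq_iff sum_negf)

lemma matrix_add_rdistrib:
  fixes M N :: "'a::semiring_1^'n^'m"
  shows "(M + N) ** L = M ** L + N ** L"
  by (simp add: matrix_matrix_mult_def vec_eq_iff distrib_right sum.distrib)

lemma matrix_inv_left: "invertible M \<Longrightarrow> matrix_inv M ** M = mat 1"
  unfolding invertible_def matrix_inv_def by (rule someI2_ex) auto

lemma symmetric_inner_commute:
  assumes "symmetric_matrix X"
  shows "v \<bullet> (X *v w) = w \<bullet> (X *v v)"
  using assms inner_transpose_mult_vec[of v X w]
  unfolding symmetric_matrix_def by (simp add: inner_commute del: transpose_matrix_vector)

lemma pos_semidef_Cauchy_Schwarz:
  assumes "pos_semidef X"
  shows "(v \<bullet> (X *v w))\<^sup>2 \<le> (v \<bullet> (X *v v)) * (w \<bullet> (X *v w))"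
proof -
  have sym: "w \<bullet> (X *v v) = v \<bullet> (X *v w)"
    using assms by (simp add: pos_semidef_def symmetric_inner_commute)
  have *: "0 \<le> s * s * (v \<bullet> (X *v v)) + 2 * s * t * (v \<bullet> (X *v w)) + t * t * (w \<bullet> (X *v w))"
    for s t
  proof -
    have "0 \<le> (s *\<^sub>R v + t *\<^sub>R w) \<bullet> (X *v (s *\<^sub>R v + t *\<^sub>R w))"
      using assms by (simp add: pos_semidef_def)
    also have "\<dots> = s * s * (v \<bullet> (X *v v)) + 2 * s * t * (v \<bullet> (X *v w)) + t * t * (w \<bullet> (X *v w))"
      by (simp add: matrix_vector_right_distrib matrix_vector_mult_scaleR inner_add_left
          inner_add_right sym algebra_simps)
    finally show ?thesis .
  qed
  define a b c where "a = v \<bullet> (X *v v)" and "b = v \<bullet> (X *v w)" and "c = w \<bullet> (X *v w)"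
  have form: "0 \<le> s * s * a + 2 * s * t * b + t * t * c" for s t
    using * by (simp add: a_def b_def c_def)
  have "b\<^sup>2 \<le> a * c"
  proof (cases "a = 0")
    case True
    have "b = 0"
    proof (rule ccontr)
      assume "b \<noteq> 0"
      \<comment> \<open>For \<open>a = 0\<close> and \<open>t = 1\<close> the form is affine in
        \<open>s\<close>; this \<open>s\<close> gives it the value \<open>-1\<close>.\<close>
      with form[of "- (c + 1) / (2 * b)" 1] True show False
        by (simp add: field_simps)
    qed
    with True show ?thesis by simp
  next
    case False
    with form[of 1 0] have "a > 0" by simp
    \<comment> \<open>The right-hand side is the form at \<open>(b, -a)\<close>.\<close>
    moreover have "0 \<le> a * (a * c - b\<^sup>2)"
      using form[of b "- a"] by (simp add: power2_eq_square algebra_simps)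
    ultimately show ?thesis
      by (simp add: zero_le_mult_iff)
  qed
  then show ?thesis
    by (simp add: a_def b_def c_def)
qed

lemma pos_semidef_kernel:
  assumes "pos_semidef X" and "v \<bullet> (X *v v) = 0"
  shows "X *v v = 0"
  using pos_semidef_Cauchy_Schwarz[OF assms(1), of "X *v v" v] assms(2) by simp

text \<open>The component \<open>r\<close> of \<open>x\<close> orthogonal to the range lies in the
  kernel by symmetry, so \<open>r \<bullet> r = r \<bullet> x = 0\<close>. The resulting
  \<open>p\<close> stands in for \<open>X\<^sup>-\<^sup>1 x\<close> when \<open>X\<close> may be
  singular.\<close>

lemma symmetric_matrix_range:
  assumes "symmetric_matrix X" and "\<And>w. X *v w = 0 \<Longrightarrow> w \<bullet> x = 0"
  obtains p where "x = X *v p"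
proof -
  have "subspace (range ((*v) X))"
    by (intro linear_subspace_image) auto
  then obtain y r where y: "y \<in> span (range ((*v) X))"
    and r: "\<And>w. w \<in> span (range ((*v) X)) \<Longrightarrow> orthogonal r w" and x: "x = y + r"
    using orthogonal_subspace_decomp_exists[of "range ((*v) X)" x] by metis
  obtain p where p: "y = X *v p"
    using y \<open>subspace (range ((*v) X))\<close> by (auto simp: span_eq_iff[THEN iffD2])
  have perp: "r \<bullet> (X *v v) = 0" for v
    using r[of "X *v v"] by (simp add: orthogonal_def span_base)
  have "(X *v r) \<bullet> (X *v r) = 0"
    using symmetric_inner_commute[OF assms(1), of "X *v r" r] perp by simp
  then have "r \<bullet> x = 0"
    using assms(2) by simp
  then have "r = 0"
    using perp[of p] by (simp add: x p inner_add_right)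
  then show thesis
    using that x p by simp
qed

section \<open>Spectral radius\<close>

lemma det_mat: "det (mat c :: 'a::comm_ring_1^'n^'n) = c ^ CARD('n)"
  by (simp add: mat_def det_diagonal)

lemma poly_det:
  fixes P :: "'a::comm_ring_1 poly^'n^'n"
  shows "poly (det P) x = det (map_matrix (\<lambda>p. poly p x) P)"
  by (simp add: det_def poly_sum poly_prod map_matrix_def)

lemma det_0_iff_kernel:
  fixes M :: "'a::field^'n^'n"
  shows "det M = 0 \<longleftrightarrow> (\<exists>v. v \<noteq> 0 \<and> M *v v = 0)"
  using invertible_det_nz[of M] matrix_left_invertible_ker[of M] invertible_left_inverse[of M]
  by auto

lemma mat_mult_vec: "mat c *v v = c *s v" for v :: "'a::semiring_1^'n"
  by (simp add: matrix_vector_mult_def mat_def vec_eq_iff if_distrib[of "\<lambda>x. x * y" for y]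
      cong: if_cong)

lemma eigenvalue_iff_det:
  fixes M :: "'a::field^'n^'n"
  shows "(\<exists>v. v \<noteq> 0 \<and> M *v v = l *s v) \<longleftrightarrow> det (M - mat l) = 0"
  by (simp add: det_0_iff_kernel matrix_vector_mult_diff_rdistrib mat_mult_vec)

lemma mat_mult_nth: "(mat t ** M) $ i $ j = t * M $ i $ j" for M :: "'a::semiring_1^'n^'m"
  by (simp add: mat_def matrix_matrix_mult_def if_distrib[of "\<lambda>x. x * y" for y] cong: if_cong)

text \<open>
  The characteristic polynomial \<open>p\<close> is not constant: its reversal \<open>q(t) = det (t M - 1)\<close> satisfies
  \<open>q(t) = t\<^sup>n p(1/t)\<close> for \<open>t \<noteq> 0\<close>, and if \<open>p\<close> were constant then \<open>q(0) = 0\<close> by continuity.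
\<close>

lemma det_minus_mat_nonconstant_poly:
  fixes M :: "complex^'n^'n"
  obtains p where "\<And>l. poly p l = det (M - mat l)" and "\<not> constant (poly p)"
proof -
  define p where "p = det (\<chi> i j. [:M $ i $ j, if i = j then -1 else 0:])"
  define q where "q = det (\<chi> i j. [:if i = j then -1 else 0, M $ i $ j:])"
  have p: "poly p l = det (M - mat l)" for l
    unfolding p_def poly_det
    by (rule arg_cong[where f = det]) (simp add: vec_eq_iff map_matrix_def mat_def)
  have q: "poly q t = det (mat t ** M - mat 1)" for t
    unfolding q_def poly_det
    by (rule arg_cong[where f = det])
      (simp add: vec_eq_iff map_matrix_def mat_mult_nth, simp add: mat_def)
  have "\<not> constant (poly p)"
  proof
    assume "constant (poly p)"
    then obtain c where c: "poly p l = c" for l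
      by (metis constant_def)
    have "poly q t = poly (monom c CARD('n)) t" if "t \<noteq> 0" for t
    proof -
      have "mat t ** M - mat 1 = mat t ** (M - mat (1 / t))"
        using that
        by (simp add: vec_eq_iff mat_mult_nth) (simp add: mat_def right_diff_distrib)
      then show ?thesis
        by (simp add: q det_mul det_mat p[symmetric] c poly_monom)
    qed
    \<comment> \<open>Polynomials that agree off 0 agree at infinitely many points, hence also at
      0.\<close>
    then have "{t. poly (q - monom c CARD('n)) t = 0} \<supseteq> - {0}"
      by auto
    moreover have "infinite (- {0 :: complex})"
      by (simp add: infinite_UNIV_char_0 Compl_eq_Diff_UNIV)
    ultimately have "q = monom c CARD('n)"
      by (metis poly_roots_finite finite_subset right_minus_eq)
    then have "poly q 0 = 0"
      by (simp add: poly_monom)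
    \<comment> \<open>Yet at 0 the value of \<open>q\<close> is the determinant of
      \<open>mat (-1)\<close>, which is not zero.\<close>
    moreover have "mat 0 ** M - mat 1 = (mat (-1) :: complex^'n^'n)"
      by (simp add: vec_eq_iff mat_mult_nth) (simp add: mat_def)
    ultimately show False
      by (simp add: q det_mat)
  qed
  with p show thesis
    using that by blast
qed

text \<open>\<open>Max\<close> has its intended meaning only on a finite nonempty set. The
  eigenvalues are the roots of a nonzero polynomial, hence finitely many, and the fundamental
  theorem of algebra provides one.\<close>

lemma spectral_radius_less_iff:
  fixes M :: "real^'n^'n"
  shows "spectral_radius M < r \<longleftrightarrow>
    (\<forall>l v. v \<noteq> 0 \<longrightarrow> map_matrix complex_of_real M *v v = l *s v \<longrightarrow> cmod l < r)"
proof -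
  obtain p where p: "\<And>l. poly p l = det (map_matrix complex_of_real M - mat l)"
    and nc: "\<not> constant (poly p)"
    using det_minus_mat_nonconstant_poly by blast
  have ev: "(\<exists>v. v \<noteq> 0 \<and> map_matrix complex_of_real M *v v = l *s v) \<longleftrightarrow> poly p l = 0" for l
    by (simp add: eigenvalue_iff_det p)
  have "p \<noteq> 0"
    using nc by (auto simp: constant_def)
  then have "finite (cmod ` {l. poly p l = 0})"
    by (simp add: poly_roots_finite)
  moreover have "cmod ` {l. poly p l = 0} \<noteq> {}"
    using fundamental_theorem_of_algebra[OF nc] by auto
  moreover have "spectral_radius M = Max (cmod ` {l. poly p l = 0})"
    unfolding spectral_radius_def ev by (rule arg_cong[where f = Max]) auto
  ultimately show ?thesis
    using ev by (auto simp: Max_less_iff)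
qed

text \<open>Split a complex eigenvector of \<open>transpose M\<close> into real and imaginary parts
  \<open>a\<close> and \<open>b\<close>. The sum of the \<open>Z\<close>-forms at \<open>a\<close>
  and \<open>b\<close> is multiplied by the squared modulus of the eigenvalue, yet it strictly
  decreases.\<close>

lemma spectral_radius_less_1_if_Lyapunov:
  fixes M Z :: "real^'n^'n"
  assumes pos: "\<And>w. w \<noteq> 0 \<Longrightarrow> 0 < w \<bullet> (Z *v w)"
    and decr: "\<And>w. w \<noteq> 0 \<Longrightarrow>
      (transpose M *v w) \<bullet> (Z *v (transpose M *v w)) < w \<bullet> (Z *v w)"
  shows "spectral_radius M < 1"
  unfolding spectral_radius_less_iff
proof (intro allI impI)
  fix l and v :: "complex^'n"
  assume "v \<noteq> 0" and "map_matrix complex_of_real M *v v = l *s v"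
  then have "det (map_matrix complex_of_real M - mat l) = 0"
    using eigenvalue_iff_det by blast
  moreover have "transpose (map_matrix complex_of_real M - mat l) =
      map_matrix complex_of_real (transpose M) - mat l"
    by (simp add: vec_eq_iff transpose_def map_matrix_def mat_def)
  ultimately obtain w where "w \<noteq> 0" and w: "map_matrix complex_of_real (transpose M) *v w = l *s w"
    by (metis det_transpose eigenvalue_iff_det)
  define a b :: "real^'n" where "a = (\<chi> i. Re (w $ i))" and "b = (\<chi> i. Im (w $ i))"
  define N where "N = transpose M"
  define q where "q u = u \<bullet> (Z *v u)" for u
  have nth: "(\<Sum>j\<in>UNIV. complex_of_real (N $ i $ j) * w $ j) = l * w $ i" for i
    using w by (simp add: vec_eq_iff matrix_vector_mult_def map_matrix_def N_def)
  have Na: "N *v a = Re l *\<^sub>R a - Im l *\<^sub>R b"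
    using arg_cong[OF nth, of Re] by (simp add: vec_eq_iff matrix_vector_mult_def a_def b_def)
  have Nb: "N *v b = Re l *\<^sub>R b + Im l *\<^sub>R a"
    using arg_cong[OF nth, of Im] by (simp add: vec_eq_iff matrix_vector_mult_def a_def b_def)
  \<comment> \<open>The cross terms with factor \<open>Re l * Im l\<close> cancel between the two
    summands.\<close>
  have eq: "q (N *v a) + q (N *v b) = (cmod l)\<^sup>2 * (q a + q b)"
    unfolding Na Nb q_def cmod_power2
    by (simp add: matrix_vector_right_distrib matrix_vector_mult_diff_distrib
        matrix_vector_mult_scaleR inner_add_left inner_diff_left inner_add_right inner_diff_right
        power2_eq_square algebra_simps)
  have "a \<noteq> 0 \<or> b \<noteq> 0"
    using \<open>w \<noteq> 0\<close> by (auto simp: vec_eq_iff a_def b_def complex_eq_iff)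
  moreover have "0 \<le> q u" "q (N *v u) \<le> q u" for u
    using pos[of u] decr[of u] by (cases "u = 0"; simp add: q_def N_def)+
  moreover have "u \<noteq> 0 \<Longrightarrow> 0 < q u" "u \<noteq> 0 \<Longrightarrow> q (N *v u) < q u" for u
    using pos decr by (simp_all add: q_def N_def)
  ultimately have "q (N *v a) + q (N *v b) < q a + q b" and "0 < q a + q b"
    by (metis add_less_le_mono add_le_less_mono, metis add_pos_nonneg add_nonneg_pos)
  then have "(cmod l)\<^sup>2 < 1"
    unfolding eq by simp
  then show "cmod l < 1"
    by (simp add: power_less_one_iff abs_square_less_1)
qed

section \<open>The matrix inequalities\<close>

text \<open>The diagonal block contributes \<open>2 * (s \<bullet> (G *v s))\<close>, which the
  off-diagonal term cancels.\<close>

lemma slack_variable_elimination: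
  fixes G X :: "real^'n^'n" and s :: "real^'n"
  shows "(- s) \<bullet> ((G + transpose G - X) *v (- s)) + 2 * (s \<bullet> (G *v (- s))) = - (s \<bullet> (X *v s))"
proof -
  have "s \<bullet> (transpose G *v s) = s \<bullet> (G *v s)"
    by (simp add: inner_transpose_mult_vec inner_commute del: transpose_matrix_vector)
  then show ?thesis
    by (simp add: matrix_vector_mult_add_rdistrib matrix_vector_mult_diff_rdistrib inner_add_right
        inner_diff_right matrix_vector_mult_minus_right del: transpose_matrix_vector)
qed

text \<open>Adding the hypotheses makes \<open>2 * (v \<bullet> (G *v v))\<close> positive, so
  \<open>G\<close> has trivial kernel.\<close>

lemma invertible_if_transpose_sum_pos:
  fixes G Z :: "real^'n^'n"
  assumes "\<And>v. v \<noteq> 0 \<Longrightarrow> 0 < v \<bullet> ((G + transpose G - Z) *v v)"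
    and "\<And>v. v \<noteq> 0 \<Longrightarrow> 0 < v \<bullet> (Z *v v)"
  shows "invertible G"
proof -
  have "v = 0" if "G *v v = 0" for v
  proof (rule ccontr)
    assume "v \<noteq> 0"
    then have "0 < v \<bullet> ((G + transpose G) *v v)"
      using assms[of v] by (simp add: matrix_vector_mult_diff_rdistrib inner_diff_right)
    then show False
      using that
      by (simp add: matrix_vector_mult_add_rdistrib inner_add_right inner_transpose_mult_vec
          del: transpose_matrix_vector)
  qed
  then show ?thesis
    by (metis det_0_iff_kernel invertible_det_nz)
qed

text \<open>The number of rows of \<open>A\<close> is arbitrary so that
  \<open>C ** G + D ** Y\<close> is covered too.\<close>

lemma closed_loop_factor:
  fixes A :: "real^'n^'k" and B :: "real^'m^'k" and G :: "real^'n^'n"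
  assumes "invertible G"
  shows "A ** G + B ** Y = (A + B ** (Y ** matrix_inv G)) ** G"
  using matrix_inv_left[OF assms]
  by (simp add: matrix_add_rdistrib matrix_mul_assoc[symmetric])

section \<open>Dissipation along the closed loop and the cost bound\<close>

text \<open>
  The dual form of \<open>N\<^sup>T X\<^sup>-\<^sup>1 N + E\<^sup>T E \<le> X\<^sup>-\<^sup>1\<close>, with \<open>x\<^sup>T X\<^sup>-\<^sup>1 x\<close> read as \<open>p\<^sup>T X p\<close> for any solution
  \<open>p\<close> of \<open>x = X p\<close>, so that \<open>X\<close> may be singular.
\<close>

lemma dual_dissipation_step:
  fixes X N :: "real^'n^'n" and E :: "real^'n^'p"
  assumes X: "pos_semidef X"
    and dual: "\<And>w z. (transpose N *v w + transpose E *v z) \<bullet>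
        (X *v (transpose N *v w + transpose E *v z)) \<le> w \<bullet> (X *v w) + z \<bullet> z"
  obtains q where "N *v (X *v p) = X *v q"
    and "q \<bullet> (X *v q) + (E *v (X *v p)) \<bullet> (E *v (X *v p)) \<le> p \<bullet> (X *v p)"
proof -
  have sym: "symmetric_matrix X" and nonneg: "\<And>v. 0 \<le> v \<bullet> (X *v v)"
    using X by (auto simp: pos_semidef_def)
  \<comment> \<open>By \<open>dual\<close> with \<open>z = 0\<close>, \<open>transpose N\<close>
    preserves the kernel of \<open>X\<close>; hence \<open>N *v (X *v p)\<close> is orthogonal to
    that kernel and lies in the range.\<close>
  have "w \<bullet> (N *v (X *v p)) = 0" if "X *v w = 0" for w
  proof -
    have "(transpose N *v w) \<bullet> (X *v (transpose N *v w)) = 0"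
      using dual[of w 0] nonneg[of "transpose N *v w"] that by simp
    then have "X *v (transpose N *v w) = 0"
      using pos_semidef_kernel[OF X] by blast
    then have "(X *v p) \<bullet> (transpose N *v w) = 0"
      using symmetric_inner_commute[OF sym, of "transpose N *v w" p] by (simp add: inner_commute)
    then show ?thesis
      by (simp add: inner_transpose_mult_vec inner_commute del: transpose_matrix_vector)
  qed
  then obtain q where q: "N *v (X *v p) = X *v q"
    using symmetric_matrix_range[OF sym] by blast
  \<comment> \<open>With this choice \<open>p \<bullet> (X *v s) = a\<close>, while
    \<open>dual\<close> bounds \<open>s \<bullet> (X *v s)\<close> by \<open>a\<close>;
    Cauchy-Schwarz then lets one factor \<open>a\<close> be divided out.\<close>
  define e where "e = E *v (X *v p)"
  define s where "s = transpose N *v q + transpose E *v e"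
  define a where "a = q \<bullet> (X *v q) + e \<bullet> e"
  have "p \<bullet> (X *v s) = (X *v p) \<bullet> s"
    using symmetric_inner_commute[OF sym, of p s] by (simp add: inner_commute)
  also have "\<dots> = a"
    by (simp add: s_def a_def inner_add_right inner_transpose_mult_vec q e_def
        inner_commute del: transpose_matrix_vector)
  finally have "a\<^sup>2 \<le> (p \<bullet> (X *v p)) * (s \<bullet> (X *v s))"
    using pos_semidef_Cauchy_Schwarz[OF X, of p s] by simp
  also have "\<dots> \<le> (p \<bullet> (X *v p)) * a"
    using dual[of q e] nonneg[of p] by (intro mult_left_mono) (auto simp: s_def a_def)
  finally have "a * a \<le> (p \<bullet> (X *v p)) * a"
    by (simp add: power2_eq_square)
  moreover have "0 \<le> a"
    using nonneg[of q] by (simp add: a_def)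
  ultimately have "a \<le> p \<bullet> (X *v p)"
    using nonneg[of p] by (cases "a = 0") auto
  then show thesis
    using that q by (simp add: a_def e_def)
qed

lemma discounted_cost_le:
  fixes A :: "real^'n^'n" and B :: "real^'m^'n" and C :: "real^'n^'p" and D :: "real^'m^'p"
  assumes "0 \<le> \<gamma>" and X: "pos_semidef X" and orth: "transpose C ** D = 0"
    and dual: "\<And>w z. (transpose (sqrt \<gamma> *\<^sub>R (A + B ** K)) *v w + transpose (C + D ** K) *v z) \<bullet>
        (X *v (transpose (sqrt \<gamma> *\<^sub>R (A + B ** K)) *v w + transpose (C + D ** K) *v z))
        \<le> w \<bullet> (X *v w) + z \<bullet> z"
  shows "discounted_cost A B (transpose C ** C) (transpose D ** D) \<gamma> (X *v p) K
    \<le> ereal (p \<bullet> (X *v p))"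
proof -
  define x where "x = state A B K (X *v p)"
  define N where "N = sqrt \<gamma> *\<^sub>R (A + B ** K)"
  define E where "E = C + D ** K"
  define c where "c k = \<gamma> ^ k * ((E *v x k) \<bullet> (E *v x k))" for k
  \<comment> \<open>Since \<open>transpose C ** D = 0\<close>, the cross terms of the squared norm
    of \<open>E *v y\<close> vanish.\<close>
  have stage: "y \<bullet> ((transpose C ** C) *v y) + (K *v y) \<bullet> ((transpose D ** D) *v (K *v y))
      = (E *v y) \<bullet> (E *v y)" for y
  proof -
    have "(C *v y) \<bullet> (D *v (K *v y)) = y \<bullet> ((transpose C ** D) *v (K *v y))"
      by (simp add: inner_transpose_mult_vec matrix_vector_mul_assoc[symmetric]
          del: transpose_matrix_vector)
    then have "(C *v y) \<bullet> (D *v (K *v y)) = 0"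
      by (simp add: orth)
    then show ?thesis
      by (simp add: E_def matrix_vector_mult_add_rdistrib matrix_vector_mul_assoc[symmetric]
          inner_transpose_mult_vec inner_add_left inner_add_right inner_commute
          del: transpose_matrix_vector)
  qed
  have cost: "discounted_cost A B (transpose C ** C) (transpose D ** D) \<gamma> (X *v p) K
      = (\<Sum>k. ereal (c k))"
    by (simp add: discounted_cost_def Let_def stage c_def x_def)
  \<comment> \<open>Invariant: cost paid so far plus storage at the scaled state is at most the
    initial storage. Scaling by \<open>sqrt \<gamma> ^ k\<close> turns the discounted dynamics into
    iteration of \<open>N\<close>.\<close>
  have "\<exists>q. sqrt \<gamma> ^ k *\<^sub>R x k = X *v q \<and> sum c {..<k} + q \<bullet> (X *v q) \<le> p \<bullet> (X *v p)" for k
  proof (induction k)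
    case 0
    show ?case
      by (auto simp: x_def intro: exI[of _ p])
  next
    case (Suc k)
    then obtain q where q: "sqrt \<gamma> ^ k *\<^sub>R x k = X *v q"
      and le: "sum c {..<k} + q \<bullet> (X *v q) \<le> p \<bullet> (X *v p)"
      by blast
    obtain q' where q': "N *v (X *v q) = X *v q'"
      and le': "q' \<bullet> (X *v q') + (E *v (X *v q)) \<bullet> (E *v (X *v q)) \<le> q \<bullet> (X *v q)"
      using dual_dissipation_step[OF X, of N E q] dual by (auto simp: N_def E_def)
    have "sqrt \<gamma> ^ Suc k *\<^sub>R x (Suc k) = N *v (X *v q)"
      by (simp add: q[symmetric] N_def x_def matrix_vector_mult_add_rdistrib
          scaleR_matrix_vector_assoc[symmetric] matrix_vector_mult_scaleR
          matrix_vector_mul_assoc[symmetric] scaleR_add_right mult.commute)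
    moreover have "(E *v (X *v q)) \<bullet> (E *v (X *v q)) = c k"
    proof -
      have "sqrt \<gamma> ^ k * sqrt \<gamma> ^ k = \<gamma> ^ k"
        using assms(1) by (simp add: power_mult_distrib[symmetric])
      then show ?thesis
        by (simp add: q[symmetric] c_def matrix_vector_mult_scaleR mult.assoc[symmetric])
    qed
    ultimately show ?case
      using q' le le' by (intro exI[of _ q']) auto
  qed
  moreover have "0 \<le> q \<bullet> (X *v q)" for q
    using X by (simp add: pos_semidef_def)
  ultimately have "sum c {..<k} \<le> p \<bullet> (X *v p)" for k
    by (metis add_increasing2 dual_order.refl order_trans)
  moreover have "0 \<le> c k" for k
    using assms(1) by (simp add: c_def)
  ultimately show ?thesis
    unfolding cost by (intro suminf_bound) (auto simp: sum_ereal)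
qed

section \<open>Consequences of the individual inequalities\<close>

lemma columnvector_block_nonneg_iff:
  fixes x0 :: "real^'n"
  shows "pos_semidef (sym_block2 (mat \<mu> :: real^1^1) (columnvector x0) X) \<longleftrightarrow>
    symmetric_matrix X \<and> (\<forall>t w. 0 \<le> \<mu> * t\<^sup>2 + 2 * t * (w \<bullet> x0) + w \<bullet> (X *v w))"
proof -
  have sym: "symmetric_matrix (mat \<mu> :: real^1^1)"
    by (simp add: symmetric_matrix_def transpose_mat)
  have form: "v \<bullet> ((mat \<mu> :: real^1^1) *v v) + 2 * (w \<bullet> (columnvector x0 *v v)) + w \<bullet> (X *v w)
      = \<mu> * (v $ 1)\<^sup>2 + 2 * (v $ 1) * (w \<bullet> x0) + w \<bullet> (X *v w)" for v w
  proof -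
    have "columnvector x0 *v v = (v $ 1) *\<^sub>R x0"
      by (simp add: vec_eq_iff matrix_vector_mult_def columnvector_def sum_1)
    moreover have "v \<bullet> ((mat \<mu> :: real^1^1) *v v) = \<mu> * (v $ 1)\<^sup>2"
      by (simp add: inner_vec_def mat_mult_vec sum_1 power2_eq_square)
    ultimately show ?thesis by simp
  qed
  show ?thesis
    unfolding pos_semidef_sym_block2_iff form by (simp add: sym forall_vector_1)
qed

lemma lmi_system_pos_semidef:
  assumes "lmi_system A B C D \<mu> x0 \<gamma> X Z G Y"
  shows "pos_semidef X"
proof -
  have "symmetric_matrix X" and *: "\<And>t w. 0 \<le> \<mu> * t\<^sup>2 + 2 * t * (w \<bullet> x0) + w \<bullet> (X *v w)"
    using assms by (auto simp: lmi_system_def columnvector_block_nonneg_iff)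
  with *[of 0] show ?thesis
    by (simp add: pos_semidef_def)
qed

lemma lmi_system_initial_state:
  assumes "lmi_system A B C D \<mu> x0 \<gamma> X Z G Y" and "\<mu> > 0"
  obtains p where "x0 = X *v p"
proof -
  have sym: "symmetric_matrix X"
    and form: "\<And>t w. 0 \<le> \<mu> * t\<^sup>2 + 2 * t * (w \<bullet> x0) + w \<bullet> (X *v w)"
    using assms by (auto simp: lmi_system_def columnvector_block_nonneg_iff)
  have "w \<bullet> x0 = 0" if "X *v w = 0" for w
  proof -
    \<comment> \<open>For \<open>w\<close> in the kernel of \<open>X\<close>, this is the minimum
      over \<open>t\<close> of the form.\<close>
    have "0 \<le> - ((w \<bullet> x0)\<^sup>2 / \<mu>)"
      using form[of "- (w \<bullet> x0) / \<mu>" w] that \<open>\<mu> > 0\<close>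
      by (simp add: power2_eq_square field_simps)
    then show ?thesis
      using \<open>\<mu> > 0\<close> by (simp add: field_simps)
  qed
  then show thesis
    using symmetric_matrix_range[OF sym] that by blast
qed

lemma lmi_system_initial_bound:
  assumes "lmi_system A B C D \<mu> (X *v p) \<gamma> X Z G Y"
  shows "p \<bullet> (X *v p) \<le> \<mu>"
proof -
  \<comment> \<open>The choice \<open>w = - p\<close> minimises the form at \<open>t = 1\<close>,
    leaving \<open>\<mu> - p \<bullet> (X *v p)\<close>.\<close>
  have "0 \<le> \<mu> * 1\<^sup>2 + 2 * 1 * ((- p) \<bullet> (X *v p)) + (- p) \<bullet> (X *v (- p))"
    using assms unfolding lmi_system_def columnvector_block_nonneg_iff by blast
  then show ?thesis
    by (simp add: matrix_vector_mult_minus_right)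
qed

lemma lmi_system_stabilizing:
  assumes "lmi_system A B C D \<mu> x0 \<gamma> X Z G Y"
  shows "invertible G" and "spectral_radius (A + B ** (Y ** matrix_inv G)) < 1"
proof -
  have form: "0 < v \<bullet> ((G + transpose G - Z) *v v) + 2 * (w \<bullet> ((A ** G + B ** Y) *v v)) + w \<bullet> (Z *v w)"
    if "v \<noteq> 0 \<or> w \<noteq> 0" for v w
    using assms that by (simp add: lmi_system_def pos_def_sym_block2_iff)
  have Z: "0 < w \<bullet> (Z *v w)" if "w \<noteq> 0" for w
    using form[of 0 w] that by simp
  show inv: "invertible G"
    by (rule invertible_if_transpose_sum_pos[OF _ Z]) (use form[of _ 0] in auto)
  define M where "M = A + B ** (Y ** matrix_inv G)"
  have "(transpose M *v w) \<bullet> (Z *v (transpose M *v w)) < w \<bullet> (Z *v w)" if "w \<noteq> 0" for w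
  proof -
    define s where "s = transpose M *v w"
    \<comment> \<open>Moving \<open>M\<close> to the left factor gives exactly the term that
      \<open>slack_variable_elimination\<close> cancels.\<close>
    have "w \<bullet> ((A ** G + B ** Y) *v (- s)) = s \<bullet> (G *v (- s))"
      unfolding closed_loop_factor[OF inv] s_def M_def[symmetric]
      by (metis inner_commute inner_transpose_mult_vec matrix_vector_mul_assoc)
    then show ?thesis
      using form[of "- s" w] slack_variable_elimination[of s G Z] that by (simp add: s_def)
  qed
  then show "spectral_radius (A + B ** (Y ** matrix_inv G)) < 1"
    unfolding M_def[symmetric] by (intro spectral_radius_less_1_if_Lyapunov[OF Z])
qed

text \<open>Supplies the hypothesis \<open>dual\<close> of
  \<open>discounted_cost_le\<close>.\<close>

lemma lmi_system_dual_dissipation: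
  fixes A :: "real^'n^'n" and B :: "real^'m^'n" and C :: "real^'n^'p" and D :: "real^'m^'p"
  assumes "lmi_system A B C D \<mu> x0 \<gamma> X Z G Y"
  defines "K \<equiv> Y ** matrix_inv G"
  defines "s \<equiv> \<lambda>w z. transpose (sqrt \<gamma> *\<^sub>R (A + B ** K)) *v w + transpose (C + D ** K) *v z"
  shows "s w z \<bullet> (X *v s w z) \<le> w \<bullet> (X *v w) + z \<bullet> z"
proof -
  have inv: "invertible G"
    using lmi_system_stabilizing assms(1) by blast
  define N where "N = sqrt \<gamma> *\<^sub>R (A + B ** K)"
  define E where "E = C + D ** K"
  define u where "u = s w z"
  have N: "sqrt \<gamma> *\<^sub>R (A ** G) + sqrt \<gamma> *\<^sub>R (B ** Y) = N ** G"
    unfolding N_def K_def scaleR_add_right[symmetric] closed_loop_factor[OF inv]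
    by (simp add: scalar_matrix_assoc)
  have E: "C ** G + D ** Y = E ** G"
    unfolding E_def K_def by (rule closed_loop_factor[OF inv])
  have "0 \<le> v \<bullet> ((G + transpose G - X) *v v) + 2 * (w \<bullet> ((N ** G) *v v)) + 2 * (z \<bullet> ((E ** G) *v v))
      + w \<bullet> (X *v w) + 2 * (z \<bullet> (0 *v w)) + z \<bullet> (mat 1 *v z)" for v
    using assms(1) unfolding lmi_system_def pos_semidef_sym_block3_iff N E by blast
  then have "0 \<le> v \<bullet> ((G + transpose G - X) *v v)
      + 2 * (w \<bullet> ((N ** G) *v v) + z \<bullet> ((E ** G) *v v)) + w \<bullet> (X *v w) + z \<bullet> z" for v
    by (simp add: distrib_left add.assoc)
  note this[of "- u"]
  moreover have "w \<bullet> ((N ** G) *v (- u)) + z \<bullet> ((E ** G) *v (- u)) = u \<bullet> (G *v (- u))"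
  proof -
    have "u \<bullet> y = w \<bullet> (N *v y) + z \<bullet> (E *v y)" for y
      unfolding u_def s_def N_def[symmetric] E_def[symmetric]
      by (simp add: inner_add_right inner_transpose_mult_vec inner_commute[of _ y]
          inner_commute[of _ "_ *v y"] del: transpose_matrix_vector)
    from this[of "G *v (- u)"] show ?thesis
      by (simp only: matrix_vector_mul_assoc)
  qed
  ultimately have "u \<bullet> (X *v u) \<le> w \<bullet> (X *v w) + z \<bullet> z"
    using slack_variable_elimination[of u G X] by simp
  then show ?thesis
    by (simp add: u_def)
qed

lemma lmi_system_antimono:
  assumes sys: "lmi_system A B C D \<mu> x0 \<gamma> X Z G Y" and "0 \<le> \<gamma>'" and "\<gamma>' \<le> \<gamma>"
  shows "lmi_system A B C D \<mu> x0 \<gamma>' X Z G Y"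
proof -
  \<comment> \<open>If \<open>\<gamma> = 0\<close>, then \<open>\<gamma>' = 0\<close> as well, and
    division by zero yields the valid choice \<open>c = 0\<close>.\<close>
  obtain c where c: "sqrt \<gamma>' = c * sqrt \<gamma>" and "0 \<le> c" "c \<le> 1"
  proof
    show "sqrt \<gamma>' = sqrt (\<gamma>' / \<gamma>) * sqrt \<gamma>"
      using assms(2,3) by (cases "\<gamma> = 0") (auto simp: real_sqrt_divide)
    show "0 \<le> sqrt (\<gamma>' / \<gamma>)" "sqrt (\<gamma>' / \<gamma>) \<le> 1"
      using assms(2,3) by (auto simp: divide_le_eq)
  qed
  define P where "P = G + transpose G - X"
  define S where "S = A ** G + B ** Y"
  define T where "T = C ** G + D ** Y"
  have S: "sqrt g *\<^sub>R (A ** G) + sqrt g *\<^sub>R (B ** Y) = sqrt g *\<^sub>R S" for g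
    by (simp add: S_def scaleR_add_right)
  have form: "0 \<le> v \<bullet> (P *v v) + 2 * (w \<bullet> ((sqrt \<gamma> *\<^sub>R S) *v v)) + 2 * (z \<bullet> (T *v v))
      + w \<bullet> (X *v w) + 2 * (z \<bullet> (0 *v w)) + z \<bullet> (mat 1 *v z)" for v w z
    using sys unfolding lmi_system_def S pos_semidef_sym_block3_iff P_def T_def by blast
  have "0 \<le> v \<bullet> (P *v v) + 2 * (w \<bullet> ((sqrt \<gamma>' *\<^sub>R S) *v v)) + 2 * (z \<bullet> (T *v v))
      + w \<bullet> (X *v w) + 2 * (z \<bullet> (0 *v w)) + z \<bullet> (mat 1 *v z)" for v w z
  proof -
    \<comment> \<open>Testing with \<open>c *\<^sub>R w\<close> shrinks the \<open>X\<close> term by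
      \<open>c\<^sup>2\<close>; this nonnegative amount restores it.\<close>
    have "0 \<le> (1 - c\<^sup>2) * (w \<bullet> (X *v w))"
      using lmi_system_pos_semidef[OF sys] \<open>0 \<le> c\<close> \<open>c \<le> 1\<close>
      by (simp add: pos_semidef_def power_le_one)
    with form[of v "c *\<^sub>R w" z] show ?thesis
      by (simp add: c scaleR_matrix_vector_assoc[symmetric] matrix_vector_mult_scaleR
          power2_eq_square algebra_simps)
  qed
  then show ?thesis
    using sys unfolding lmi_system_def S pos_semidef_sym_block3_iff P_def T_def by blast
qed

text \<open>The system admits singular \<open>X\<close>, for instance \<open>X = 0\<close> when
  \<open>\<gamma> = 0\<close> and \<open>x0 = 0\<close>. The bounds through
  \<open>matrix_inv X\<close> are therefore conditional, while the bound by \<open>\<mu>\<close> is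
  stated for every solution.\<close>

theorem theorem3:
  fixes A :: "real^'n^'n" and B :: "real^'m^'n"
    and C :: "real^'n^'p" and D :: "real^'m^'p"
    and Q :: "real^'n^'n" and R :: "real^'m^'m"
    and \<gamma> \<mu> :: real and x0 :: "real^'n"
  assumes "stabilizable A B"
    and "Q = transpose C ** C" and "pos_def Q"
    and "R = transpose D ** D" and "pos_def R"
    and "transpose C ** D = 0"
    and "\<gamma> \<in> {0..1}" and "\<mu> > 0"
  shows "(\<forall>X Z G Y. lmi_system A B C D \<mu> x0 \<gamma> X Z G Y \<longrightarrow>
            invertible G \<and>
            Y ** matrix_inv G \<in> stabilizing_gains A B \<and>
            (invertible X \<longrightarrow>
               discounted_cost A B Q R \<gamma> x0 (Y ** matrix_inv G)
                 \<le> ereal (x0 \<bullet> (matrix_inv X *v x0)) \<and>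
               x0 \<bullet> (matrix_inv X *v x0) \<le> \<mu>) \<and>
            discounted_cost A B Q R \<gamma> x0 (Y ** matrix_inv G) \<le> ereal \<mu>) \<and>
         ((\<exists>X Z G Y. lmi_system A B C D \<mu> x0 \<gamma> X Z G Y) \<longrightarrow>
            (\<forall>\<gamma>'\<in>{0..\<gamma>}. \<exists>X Z G Y. lmi_system A B C D \<mu> x0 \<gamma>' X Z G Y))"
proof (intro conjI allI impI)
  fix X Z G Y
  assume sys: "lmi_system A B C D \<mu> x0 \<gamma> X Z G Y"
  show "invertible G" "Y ** matrix_inv G \<in> stabilizing_gains A B"
    using lmi_system_stabilizing[OF sys] by (simp_all add: stabilizing_gains_def)
  obtain p where p: "x0 = X *v p"
    using lmi_system_initial_state[OF sys \<open>\<mu> > 0\<close>] .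
  have bound: "p \<bullet> (X *v p) \<le> \<mu>"
    using lmi_system_initial_bound sys unfolding p .
  have cost: "discounted_cost A B Q R \<gamma> x0 (Y ** matrix_inv G) \<le> ereal (p \<bullet> (X *v p))"
    unfolding p assms(2,4) using assms(6,7) lmi_system_dual_dissipation[OF sys]
    by (intro discounted_cost_le lmi_system_pos_semidef[OF sys]) auto
  show "discounted_cost A B Q R \<gamma> x0 (Y ** matrix_inv G) \<le> ereal \<mu>"
    using cost bound by (meson ereal_less_eq(3) order_trans)
  assume "invertible X"
  then have "matrix_inv X *v x0 = p"
    by (simp add: p matrix_vector_mul_assoc matrix_inv_left)
  then have "x0 \<bullet> (matrix_inv X *v x0) = p \<bullet> (X *v p)"
    by (simp add: p inner_commute)
  then show "discounted_cost A B Q R \<gamma> x0 (Y ** matrix_inv G) \<le> ereal (x0 \<bullet> (matrix_inv X *v x0))"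
    and "x0 \<bullet> (matrix_inv X *v x0) \<le> \<mu>"
    using cost bound by simp_all
next
  assume "\<exists>X Z G Y. lmi_system A B C D \<mu> x0 \<gamma> X Z G Y"
  then show "\<forall>\<gamma>'\<in>{0..\<gamma>}. \<exists>X Z G Y. lmi_system A B C D \<mu> x0 \<gamma>' X Z G Y"
    using lmi_system_antimono by (metis atLeastAtMost_iff)
qed

end
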